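(* In the setting described in the context (a critical branch straightened to $u=0$, passing at $\mu=0$ through a point at which the Hessian has a one-dimensional kernel $\mathcal N=\operatorname{span}\{v_0\}$), there exist neighborhoods of $(a,\mu)=(0,0)$ and a unique smooth map $w^*(a,\mu)\in\mathcal R$ with $w^*(0,0)=0$ such that $$P_{\mathcal R}\widetilde F\bigl(av_0+w^*(a,\mu),\mu\bigr)=0 .$$ Moreover, critical points of $\widetilde L$ (with respect to $u$) near $(u,\mu)=(0,0)$ are in one-to-one correspondence with zeros of the scalar reduced equation $g(a,\mu)=0$, where $$g(a,\mu):=P_{\mathcal N}\widetilde F\bigl(av_0+w^*(a,\mu),\mu\bigr)\cdot v_0,$$ and equivalently $g(a,\mu)=\partial_a\phi(a,\mu)$ for the reduced potential $\phi(a,\mu):=\widetilde L\bigl(av_0+w^*(a,\mu),\mu\bigr)$.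
   Context: Let $\mathcal M$ be a finite-dimensional Riemannian manifold, $I\subset\mathbb R$ an open interval containing $[0,1]$, and $L\in C^k(\mathcal M\times I,\mathbb R)$ with $k\ge 4$. Write $F(\theta,\lambda):=\nabla_\theta L(\theta,\lambda)$. Assumption (smooth critical branch): there is a smooth map $\theta_0:I\to\mathcal M$ with $F(\theta_0(\lambda),\lambda)=0$ for all $\lambda\in I$. Assumption (simple degeneracy): there is $\lambda^*\in(0,1)$ such that at $\theta^*:=\theta_0(\lambda^* )$ the Hessian $H^*:=\nabla^2_\theta L(\theta^*,\lambda^* )$ has one-dimensional kernel $\mathcal N:=\operatorname{Ker}(H^* )=\operatorname{span}\{v_0\}$, $\|v_0\|=1$. Let $\mathcal R:=\mathcal N^\perp$, so $T_{\theta^*}\mathcal M=\mathcal N\oplus\mathcal R$ orthogonally; $P_{\mathcal N}$, $P_{\mathcal R}$ are the orthogonal projections. Straightened coordinates: put $\mu:=\lambda-\lambda^*$. Choose a local chart near $\theta^*$ and, after a smooth change of coordinates, a coordinate $u$ in which the critical branch is $u=0$ for all sufficiently small $\mu$. Let $\widetilde L(u,\mu)$ be the objective in these coordinates and $\widetilde F(u,\mu):=\nabla_u\widetilde L(u,\mu)$, so $\widetilde F(0,\mu)=0$ for all small $|\mu|$, and $D_u\widetilde F(0,0)=\nabla_u^2\widetilde L(0,0)$ is symmetric with one-dimensional kernel $\mathcal N=\operatorname{span}\{v_0\}$. Write $u=av_0+w$ with $a\in\mathbb R$, $w\in\mathcal R$. *)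

theory Defs
  imports "HOL-Analysis.Analysis" "HOL-Library.Extended_Nat"
begin

text \<open>The classes \<open>C\<^sup>n\<close> on an open subset \<open>S\<close> of a Euclidean space, with \<open>n\<close> a natural number or
  \<open>\<infinity>\<close>. As the dimension is finite, \<open>f\<close> is \<open>C\<^sup>n\<^sup>+\<^sup>1\<close> iff it is Frechet differentiable and every
  directional derivative \<open>x \<mapsto> Df(x) v\<close> is \<open>C\<^sup>n\<close>.\<close>

primrec C_nat_on :: "nat \<Rightarrow> 'a::euclidean_space set \<Rightarrow> ('a \<Rightarrow> 'b::real_normed_vector) \<Rightarrow> bool"
  where
    "C_nat_on 0 S f \<longleftrightarrow> continuous_on S f"
  | "C_nat_on (Suc n) S f \<longleftrightarrow>
       (\<forall>x\<in>S. f differentiable (at x)) \<and>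
       (\<forall>v. C_nat_on n S (\<lambda>x. frechet_derivative f (at x) v))"

definition C_on :: "enat \<Rightarrow> 'a::euclidean_space set \<Rightarrow> ('a \<Rightarrow> 'b::real_normed_vector) \<Rightarrow> bool"
  where "C_on k S f \<longleftrightarrow> (\<forall>n::nat. enat n \<le> k \<longrightarrow> C_nat_on n S f)"

definition orth_proj :: "'a::euclidean_space set \<Rightarrow> 'a \<Rightarrow> 'a"
  where "orth_proj S x = (THE y. y \<in> S \<and> x - y \<in> S\<^sup>\<bottom>)"

text \<open>\<open>w\<close> is a \<open>C\<^sup>m\<close> solution, on the parameter set \<open>U\<close>, of the equation projected to \<open>R\<close>;
  \<open>D\<close> is the domain of \<open>F\<close>.\<close>

definition solves_projected ::
  "enat \<Rightarrow> ('a::euclidean_space \<times> real) set \<Rightarrow> ('a \<Rightarrow> real \<Rightarrow> 'a) \<Rightarrow> 'a \<Rightarrow> 'a set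
    \<Rightarrow> (real \<times> real) set \<Rightarrow> (real \<times> real \<Rightarrow> 'a) \<Rightarrow> bool"
  where "solves_projected m D F v0 R U w \<longleftrightarrow>
    C_on m U w \<and> w (0, 0) = 0 \<and>
    (\<forall>(a, \<mu>) \<in> U. w (a, \<mu>) \<in> R \<and> (a *\<^sub>R v0 + w (a, \<mu>), \<mu>) \<in> D \<and>
       orth_proj R (F (a *\<^sub>R v0 + w (a, \<mu>)) \<mu>) = 0)"

definition reduced_map ::
  "('a::euclidean_space \<Rightarrow> real \<Rightarrow> 'a) \<Rightarrow> 'a \<Rightarrow> 'a set \<Rightarrow> (real \<times> real \<Rightarrow> 'a)
    \<Rightarrow> real \<Rightarrow> real \<Rightarrow> real"
  where "reduced_map F v0 N w a \<mu> = orth_proj N (F (a *\<^sub>R v0 + w (a, \<mu>)) \<mu>) \<bullet> v0"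

definition reduced_potential ::
  "('a::euclidean_space \<Rightarrow> real \<Rightarrow> real) \<Rightarrow> 'a \<Rightarrow> (real \<times> real \<Rightarrow> 'a) \<Rightarrow> real \<Rightarrow> real \<Rightarrow> real"
  where "reduced_potential L v0 w a \<mu> = L (a *\<^sub>R v0 + w (a, \<mu>)) \<mu>"

end

theory Submission
  imports Defs
begin

text \<open>Since \<open>H\<close> is a second derivative it is symmetric, so it maps into \<open>R = v\<^sub>0\<^sup>\<bottom>\<close> and is injective there.
  Hence \<open>G(u, \<mu>) = (P\<^sub>R F(u, \<mu>) + (u \<bullet> v\<^sub>0) v\<^sub>0, \<mu>)\<close> has injective derivative at the origin, and it has a local
  inverse \<open>g\<close>, as smooth as \<open>F\<close>. The points \<open>u = a v\<^sub>0 + w\<close> with \<open>w \<in> R\<close> that solve the projected equation are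
  exactly those with \<open>G(u, \<mu>) = (a v\<^sub>0, \<mu>)\<close>, so \<open>w\<^sup>*\<close> is read off from \<open>g(a v\<^sub>0, \<mu>)\<close>.
  On the solution set \<open>F\<close> is a multiple of \<open>v\<^sub>0\<close>, and \<open>\<partial>\<^sub>a u\<close> has \<open>v\<^sub>0\<close>-component 1, whence
  \<open>\<partial>\<^sub>a \<phi> = F \<bullet> \<partial>\<^sub>a u = F \<bullet> v\<^sub>0\<close>.\<close>

subsection \<open>Calculus of \<open>C\<^sup>n\<close> maps\<close>

text \<open>Because \<open>S\<close> is open, derivatives at its points see only values in
  \<open>S\<close>. The functions vary in the induction since their derivatives, too, agree only
  there.\<close>

lemma C_nat_on_cong:
  fixes f g :: "'a::euclidean_space \<Rightarrow> 'b::real_normed_vector"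
  assumes "open S" "C_nat_on n S f" "\<And>x. x \<in> S \<Longrightarrow> f x = g x"
  shows "C_nat_on n S g"
  using assms(2,3)
proof (induction n arbitrary: f g)
  case 0
  then show ?case by (auto cong: continuous_on_cong)
next
  case (Suc n)
  have g': "(g has_derivative frechet_derivative f (at x)) (at x)" if "x \<in> S" for x
    using Suc.prems assms(1) that
    by (auto intro: has_derivative_transform_within_open[where f = f and s = S] simp: frechet_derivative_works)
  have "C_nat_on n S (\<lambda>x. frechet_derivative f (at x) v)" for v
    using Suc.prems(1) by simp
  then have "C_nat_on n S (\<lambda>x. frechet_derivative g (at x) v)" for v
    by (rule Suc.IH) (simp flip: frechet_derivative_at[OF g'])
  with g' show ?case by (auto simp: differentiable_def)
qed

text \<open>Trades the derivative chosen by \<open>frechet_derivative\<close> for an explicit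
  formula \<open>f'\<close>, which has to be correct only on \<open>S\<close>; uniqueness of
  derivatives justifies the exchange.\<close>

lemma C_nat_on_SucI:
  assumes "open S"
    and f': "\<And>x. x \<in> S \<Longrightarrow> (f has_derivative f' x) (at x)"
    and "\<And>v. C_nat_on n S (\<lambda>x. f' x v)"
  shows "C_nat_on (Suc n) S f"
proof -
  have "C_nat_on n S (\<lambda>x. frechet_derivative f (at x) v)" for v
    by (rule C_nat_on_cong[OF assms(1,3)]) (simp flip: frechet_derivative_at[OF f'])
  with f' show ?thesis by (auto simp: differentiable_def)
qed

lemma C_nat_on_has_derivative:
  assumes "C_nat_on (Suc n) S f" "x \<in> S"
  shows "(f has_derivative frechet_derivative f (at x)) (at x)"
  using assms by (auto simp: frechet_derivative_works)

lemma C_nat_on_SucD: "C_nat_on (Suc n) S f \<Longrightarrow> C_nat_on n S f"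
proof (induction n arbitrary: f)
  case 0
  then show ?case
    by (auto intro!: continuous_at_imp_continuous_on differentiable_imp_continuous_within)
next
  case (Suc n)
  have "C_nat_on n S (\<lambda>x. frechet_derivative f (at x) v)" for v
    using Suc.prems by (intro Suc.IH) simp
  with Suc.prems show ?case by simp
qed

lemma C_nat_on_const:
  assumes "open S"
  shows "C_nat_on n S (\<lambda>x. c)"
  by (induction n arbitrary: c)
    (auto intro!: C_nat_on_SucI[OF assms, where f' = "\<lambda>_ _. 0"] simp del: C_nat_on.simps(2))

lemma C_nat_on_bounded_linear:
  assumes "open S" "bounded_linear l"
  shows "C_nat_on n S l"
proof (cases n)
  case 0
  then show ?thesis using assms by (auto intro: linear_continuous_on)
next
  case (Suc m)
  then show ?thesis
    using assms
    by (auto intro!: C_nat_on_SucI[OF assms(1), where f' = "\<lambda>_. l"] C_nat_on_const bounded_linear_imp_has_derivative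
        simp del: C_nat_on.simps(2))
qed

lemma C_nat_on_linear_compose:
  assumes "open S" "bounded_linear l" "C_nat_on n S f"
  shows "C_nat_on n S (\<lambda>x. l (f x))"
  using assms(3)
proof (induction n arbitrary: f)
  case 0
  then show ?case
    using assms(2) by (auto intro: bounded_linear.continuous_on)
next
  case (Suc n)
  show ?case
  proof (rule C_nat_on_SucI[OF assms(1)])
    show "((\<lambda>x. l (f x)) has_derivative (\<lambda>v. l (frechet_derivative f (at x) v))) (at x)" if "x \<in> S" for x
      using bounded_linear.has_derivative[OF assms(2) C_nat_on_has_derivative[OF Suc.prems that]] .
    show "C_nat_on n S (\<lambda>x. l (frechet_derivative f (at x) v))" for v
      using Suc.prems by (intro Suc.IH) simp
  qed
qed

lemma C_nat_on_add:
  assumes "open S" "C_nat_on n S f" "C_nat_on n S g"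
  shows "C_nat_on n S (\<lambda>x. f x + g x)"
  using assms(2,3)
proof (induction n arbitrary: f g)
  case 0
  then show ?case by (auto intro: continuous_on_add)
next
  case (Suc n)
  show ?case
  proof (rule C_nat_on_SucI[OF assms(1)])
    show "((\<lambda>x. f x + g x) has_derivative
        (\<lambda>v. frechet_derivative f (at x) v + frechet_derivative g (at x) v)) (at x)" if "x \<in> S" for x
      using Suc.prems that by (intro has_derivative_add C_nat_on_has_derivative)
    show "C_nat_on n S (\<lambda>x. frechet_derivative f (at x) v + frechet_derivative g (at x) v)" for v
      using Suc.prems by (intro Suc.IH) simp_all
  qed
qed

lemma C_nat_on_sum:
  assumes "open S" "\<And>i. i \<in> I \<Longrightarrow> C_nat_on n S (f i)"
  shows "C_nat_on n S (\<lambda>x. \<Sum>i\<in>I. f i x)"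
  using assms(2)
proof (induction I rule: infinite_finite_induct)
  case (insert j I)
  have "C_nat_on n S (\<lambda>x. f j x + (\<Sum>i\<in>I. f i x))"
    using insert by (intro C_nat_on_add[OF assms(1)]) simp_all
  then show ?case using insert.hyps by simp
qed (simp_all add: C_nat_on_const[OF assms(1)])

lemma C_nat_on_scaleR:
  fixes c :: "'a::euclidean_space \<Rightarrow> real"
  assumes "open S" "C_nat_on n S c" "C_nat_on n S f"
  shows "C_nat_on n S (\<lambda>x. c x *\<^sub>R f x)"
  using assms(2,3)
proof (induction n arbitrary: c f)
  case 0
  then show ?case by (auto intro: continuous_on_scaleR)
next
  case (Suc n)
  show ?case
  proof (rule C_nat_on_SucI[OF assms(1)])
    show "((\<lambda>x. c x *\<^sub>R f x) has_derivative
        (\<lambda>v. c x *\<^sub>R frechet_derivative f (at x) v + frechet_derivative c (at x) v *\<^sub>R f x)) (at x)"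
      if "x \<in> S" for x
      using Suc.prems that by (intro has_derivative_scaleR C_nat_on_has_derivative)
    show "C_nat_on n S (\<lambda>x. c x *\<^sub>R frechet_derivative f (at x) v + frechet_derivative c (at x) v *\<^sub>R f x)" for v
      using Suc.prems C_nat_on_SucD[OF Suc.prems(1)] C_nat_on_SucD[OF Suc.prems(2)]
      by (intro C_nat_on_add[OF assms(1)] Suc.IH) simp_all
  qed
qed

lemma linear_eq_sum_Basis:
  fixes A :: "'a::euclidean_space \<Rightarrow> 'b::real_vector"
  assumes "linear A"
  shows "A z = (\<Sum>i\<in>Basis. (z \<bullet> i) *\<^sub>R A i)"
proof -
  have "A z = A (\<Sum>i\<in>Basis. (z \<bullet> i) *\<^sub>R i)" by (simp add: euclidean_representation)
  also have "\<dots> = (\<Sum>i\<in>Basis. (z \<bullet> i) *\<^sub>R A i)"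
    using assms by (simp add: linear_sum linear_cmul)
  finally show ?thesis .
qed

text \<open>\<open>C_nat_on\<close> controls derivatives only in fixed directions. Expanding
  \<open>z x\<close> in the basis turns a direction that moves with \<open>x\<close> into a finite
  sum of scalar multiples of fixed ones. This is what chain rules and derivatives of inverses
  require.\<close>

lemma C_nat_on_linear_family_apply:
  fixes A :: "'a::euclidean_space \<Rightarrow> 'b::euclidean_space \<Rightarrow> 'c::real_normed_vector"
  assumes "open S" "\<And>x. x \<in> S \<Longrightarrow> linear (A x)"
    and "\<And>v. C_nat_on n S (\<lambda>x. A x v)" "C_nat_on n S z"
  shows "C_nat_on n S (\<lambda>x. A x (z x))"
proof (rule C_nat_on_cong[OF assms(1)])
  show "C_nat_on n S (\<lambda>x. \<Sum>i\<in>Basis. (z x \<bullet> i) *\<^sub>R A x i)"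
    using assms by (intro C_nat_on_sum C_nat_on_scaleR C_nat_on_linear_compose[OF _ bounded_linear_inner_left])
qed (use linear_eq_sum_Basis[OF assms(2)] in simp)

text \<open>By the chain rule a directional derivative of the composite is the linear family
  \<open>Df(g x)\<close> applied to the moving vector \<open>Dg(x) v\<close>. The induction
  hypothesis handles \<open>Df(g x)\<close> in each fixed direction, with \<open>g\<close> demoted
  to order \<open>n\<close>.\<close>

lemma C_nat_on_compose:
  fixes f :: "'b::euclidean_space \<Rightarrow> 'c::real_normed_vector"
    and g :: "'a::euclidean_space \<Rightarrow> 'b"
  assumes "open S" "C_nat_on n T f" "C_nat_on n S g" "\<And>x. x \<in> S \<Longrightarrow> g x \<in> T"
  shows "C_nat_on n S (\<lambda>x. f (g x))"
  using assms(2,3)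
proof (induction n arbitrary: f)
  case 0
  then show ?case
    using assms(4) by (auto intro!: continuous_on_compose2[of T f S g])
next
  case (Suc n)
  show ?case
  proof (rule C_nat_on_SucI[OF assms(1)])
    show "((\<lambda>x. f (g x)) has_derivative
        (\<lambda>v. frechet_derivative f (at (g x)) (frechet_derivative g (at x) v))) (at x)" if "x \<in> S" for x
      using has_derivative_compose[OF C_nat_on_has_derivative[OF Suc.prems(2) that]
          C_nat_on_has_derivative[OF Suc.prems(1) assms(4)[OF that]]] .
    show "C_nat_on n S (\<lambda>x. frechet_derivative f (at (g x)) (frechet_derivative g (at x) v))" for v
    proof (rule C_nat_on_linear_family_apply[OF assms(1)])
      show "linear (frechet_derivative f (at (g x)))" if "x \<in> S" for x
        using that Suc.prems(1) assms(4) by (auto intro: linear_frechet_derivative)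
      show "C_nat_on n S (\<lambda>x. frechet_derivative f (at (g x)) v)" for v
        using Suc.prems(1) C_nat_on_SucD[OF Suc.prems(2)] by (intro Suc.IH) simp_all
      show "C_nat_on n S (\<lambda>x. frechet_derivative g (at x) v)"
        using Suc.prems(2) by simp
    qed
  qed
qed

subsection \<open>Smoothness of inverses\<close>

text \<open>For \<open>B = A\<^sup>-\<^sup>1\<close>, the identity \<open>B\<^sub>y - B\<^sub>x = - B\<^sub>x (A\<^sub>y - A\<^sub>x) B\<^sub>y\<close> yields first the continuity of \<open>B\<close>
  and then its derivative.\<close>

lemma continuous_on_inverse_family:
  fixes A B :: "'a::euclidean_space \<Rightarrow> 'b::euclidean_space \<Rightarrow> 'b"
  assumes lin: "\<And>x. x \<in> S \<Longrightarrow> linear (A x)" "\<And>x. x \<in> S \<Longrightarrow> linear (B x)"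
    and AB: "\<And>x v. x \<in> S \<Longrightarrow> A x (B x v) = v"
    and BA: "\<And>x v. x \<in> S \<Longrightarrow> B x (A x v) = v"
    and A: "\<And>v. continuous_on S (\<lambda>x. A x v)"
  shows "continuous_on S (\<lambda>x. B x v)"
  unfolding continuous_on_def
proof
  fix x assume x: "x \<in> S"
  \<comment> \<open>The sum over the finite basis dominates the operator norm of
    \<open>A y - A x\<close> and tends to 0 by the pointwise continuity of \<open>A\<close>.\<close>
  define e where "e y = (\<Sum>i\<in>Basis. norm (A y i - A x i))" for y
  have e0: "(e \<longlongrightarrow> 0) (at x within S)"
    unfolding e_def using A x
    by (auto intro!: tendsto_null_sum tendsto_norm_zero LIM_zero simp: continuous_on_def)
  obtain K where K: "K > 0" "\<And>z. norm (B x z) \<le> norm z * K"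
    using bounded_linear.pos_bounded lin(2)[OF x] linear_conv_bounded_linear by blast
  have bound: "norm (B y v - B x v) \<le> K * e y * norm (B y v)" if y: "y \<in> S" for y
  proof -
    have "B y v - B x v = B x (A x (B y v) - A y (B y v))"
      using lin(2)[OF x] x y by (simp add: AB BA linear_diff)
    also have "norm \<dots> \<le> K * norm (A x (B y v) - A y (B y v))"
      using K(2) by (simp add: mult.commute)
    also have "A x (B y v) - A y (B y v) = (\<Sum>i\<in>Basis. (B y v \<bullet> i) *\<^sub>R (A x i - A y i))"
      using linear_eq_sum_Basis[OF lin(1)[OF x], of "B y v"] linear_eq_sum_Basis[OF lin(1)[OF y], of "B y v"]
      by (simp add: sum_subtractf scaleR_diff_right)
    also have "norm \<dots> \<le> (\<Sum>i\<in>Basis. norm (B y v) * norm (A y i - A x i))"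
      by (intro sum_norm_le) (auto intro!: mult_right_mono Basis_le_norm simp: norm_minus_commute)
    also have "\<dots> = norm (B y v) * e y" by (simp add: e_def sum_distrib_left)
    finally show ?thesis using K(1) by (simp add: mult.assoc mult.commute[of "norm (B y v)"])
  qed
  have "\<forall>\<^sub>F y in at x within S. y \<in> S" by (simp add: eventually_at_filter)
  \<comment> \<open>The estimate \<open>bound\<close> still has the unknown
    \<open>norm (B y v)\<close> on its right. Where \<open>K * e y\<close> is below 1/2 that term
    can be absorbed, which gives \<open>norm (B y v) \<le> 2 * norm (B x v)\<close>.\<close>
  moreover have "\<forall>\<^sub>F y in at x within S. e y < 1 / (2 * K)"
    using order_tendstoD(2)[OF e0] K(1) by simp
  ultimately have "\<forall>\<^sub>F y in at x within S. norm (B y v - B x v) \<le> 2 * K * norm (B x v) * e y"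
  proof eventually_elim
    fix y assume y: "y \<in> S" "e y < 1 / (2 * K)"
    have e: "0 \<le> e y" by (simp add: e_def sum_nonneg)
    have "K * e y \<le> 1 / 2" using y K(1) by (simp add: field_simps)
    then have "K * e y * norm (B y v) \<le> 1 / 2 * norm (B y v)"
      by (intro mult_right_mono) auto
    with bound[OF y(1)] have "norm (B y v) \<le> 2 * norm (B x v)"
      using norm_triangle_ineq2[of "B y v" "B x v"] by linarith
    then have "K * e y * norm (B y v) \<le> K * e y * (2 * norm (B x v))"
      using K(1) e by (intro mult_left_mono) auto
    with bound[OF y(1)] show "norm (B y v - B x v) \<le> 2 * K * norm (B x v) * e y"
      by (simp add: algebra_simps)
  qed
  moreover have "((\<lambda>y. 2 * K * norm (B x v) * e y) \<longlongrightarrow> 0) (at x within S)"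
    by (intro tendsto_mult_right_zero e0)
  ultimately have "((\<lambda>y. B y v - B x v) \<longlongrightarrow> 0) (at x within S)"
    by (rule Lim_null_comparison)
  then show "((\<lambda>y. B y v) \<longlongrightarrow> B x v) (at x within S)"
    by (rule LIM_zero_cancel)
qed

text \<open>A product rule with one factor merely continuous: the term with the derivative of
  \<open>c\<close> would be multiplied by \<open>f x = 0\<close>. It serves for the inverse family,
  whose coefficients are known to be continuous before they are known to be differentiable.\<close>

lemma has_derivative_scaleR_continuous_at_zero:
  fixes c :: "'a::real_normed_vector \<Rightarrow> real"
  assumes c: "isCont c x" and f: "(f has_derivative f') (at x)" and "f x = 0"
  shows "((\<lambda>y. c y *\<^sub>R f y) has_derivative (\<lambda>h. c x *\<^sub>R f' h)) (at x)"
proof -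
  interpret f': bounded_linear f' using f by (rule has_derivative_bounded_linear)
  obtain K where K: "K > 0" "\<And>z. norm (f' z) \<le> norm z * K"
    using f'.pos_bounded by blast
  define r where "r h = norm (f (x + h) - f' h) / norm h" for h
  have r: "(r \<longlongrightarrow> 0) (at 0)"
    using f assms(3) unfolding r_def by (simp add: has_derivative_at)
  have c0: "((\<lambda>h. c (x + h)) \<longlongrightarrow> c x) (at 0)"
    using c by (simp add: isCont_iff)
  have lim: "((\<lambda>h. \<bar>c (x + h)\<bar> * r h + \<bar>c (x + h) - c x\<bar> * K) \<longlongrightarrow> \<bar>c x\<bar> * 0 + 0 * K) (at 0)"
    using LIM_zero[OF c0]
    by (intro tendsto_intros c0 r tendsto_rabs_zero)
  have bd: "norm (norm (c (x + h) *\<^sub>R f (x + h) - c x *\<^sub>R f x - c x *\<^sub>R f' h) / norm h)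
      \<le> \<bar>c (x + h)\<bar> * r h + \<bar>c (x + h) - c x\<bar> * K" if "h \<noteq> 0" for h
  proof -
    have "c (x + h) *\<^sub>R f (x + h) - c x *\<^sub>R f x - c x *\<^sub>R f' h
        = c (x + h) *\<^sub>R (f (x + h) - f' h) + (c (x + h) - c x) *\<^sub>R f' h"
      using assms(3) by (simp add: algebra_simps)
    also have "norm \<dots> \<le> \<bar>c (x + h)\<bar> * norm (f (x + h) - f' h) + \<bar>c (x + h) - c x\<bar> * (norm h * K)"
      by (intro norm_triangle_mono) (auto intro: mult_left_mono K(2))
    finally show ?thesis
      using that by (simp add: r_def field_simps)
  qed
  have "((\<lambda>h. norm (c (x + h) *\<^sub>R f (x + h) - c x *\<^sub>R f x - c x *\<^sub>R f' h) / norm h) \<longlongrightarrow> 0) (at 0)"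
    by (rule Lim_null_comparison[OF _ lim[simplified]]) (use bd in \<open>auto simp: eventually_at_filter intro!: always_eventually\<close>)
  then show ?thesis
    by (simp add: has_derivative_at bounded_linear_scaleR_right[THEN bounded_linear_compose] f'.bounded_linear_axioms)
qed

lemma has_derivative_inverse_family:
  fixes A B :: "'a::euclidean_space \<Rightarrow> 'b::euclidean_space \<Rightarrow> 'b"
  assumes "open S" "x \<in> S"
    and lin: "\<And>x. x \<in> S \<Longrightarrow> linear (A x)" "\<And>x. x \<in> S \<Longrightarrow> linear (B x)"
    and AB: "\<And>x v. x \<in> S \<Longrightarrow> A x (B x v) = v"
    and BA: "\<And>x v. x \<in> S \<Longrightarrow> B x (A x v) = v"
    and A: "\<And>v y. y \<in> S \<Longrightarrow> ((\<lambda>x. A x v) has_derivative A' y v) (at y)"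
  shows "((\<lambda>x. B x v) has_derivative (\<lambda>h. - B x (A' x (B x v) h))) (at x)"
proof -
  note x = assms(2)
  have cont: "continuous_on S (\<lambda>x. B x v)"
    by (rule continuous_on_inverse_family[OF lin AB BA])
      (auto intro!: continuous_at_imp_continuous_on has_derivative_continuous[OF A])
  \<comment> \<open>\<open>q y\<close> is \<open>(A y - A x) (B y v)\<close> written in the basis.
    The coefficients are only continuous so far, but the other factors vanish at \<open>x\<close>,
    so the preceding product rule applies. Then \<open>B y v = B x v - B x (q y)\<close> has only
    the fixed linear map \<open>B x\<close> outside.\<close>
  define q where "q y = (\<Sum>i\<in>Basis. (B y v \<bullet> i) *\<^sub>R (A y i - A x i))" for y
  have q: "A y (B y v) - A x (B y v) = q y" if "y \<in> S" for y
    unfolding q_def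
    using linear_eq_sum_Basis[OF lin(1)[OF x], of "B y v"] linear_eq_sum_Basis[OF lin(1)[OF that], of "B y v"]
    by (simp add: sum_subtractf scaleR_diff_right)
  define Q where "Q h = (\<Sum>i\<in>Basis. (B x v \<bullet> i) *\<^sub>R A' x i h)" for h
  have dq: "(q has_derivative Q) (at x)"
    unfolding q_def Q_def
  proof (intro has_derivative_sum has_derivative_scaleR_continuous_at_zero)
    show "isCont (\<lambda>y. B y v \<bullet> i) x" for i
      using cont assms(1,2) by (intro continuous_intros) (simp add: continuous_on_eq_continuous_at)
    show "((\<lambda>y. A y i - A x i) has_derivative A' x i) (at x)" for i
      using has_derivative_diff[OF A[OF x] has_derivative_const] by simp
  qed simp
  \<comment> \<open>Differentiating with the vector \<open>B x v\<close> frozen gives the same sum,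
    which removes the basis from the formula for \<open>Q\<close>.\<close>
  have "((\<lambda>y. A y (B x v)) has_derivative Q) (at x)"
  proof -
    have "((\<lambda>y. \<Sum>i\<in>Basis. (B x v \<bullet> i) *\<^sub>R A y i) has_derivative Q) (at x)"
      unfolding Q_def by (intro has_derivative_sum has_derivative_scaleR_right A x)
    then show ?thesis
      by (rule has_derivative_transform_within_open[OF _ assms(1,2)])
        (use linear_eq_sum_Basis[OF lin(1), of _ "B x v"] in simp)
  qed
  then have Q: "Q = A' x (B x v)"
    using has_derivative_unique A[OF x] by blast
  have "((\<lambda>y. B x v - B x (q y)) has_derivative (\<lambda>h. 0 - B x (Q h))) (at x)"
    using lin(2)[OF x]
    by (intro has_derivative_diff[OF has_derivative_const bounded_linear.has_derivative[OF _ dq]])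
      (simp add: linear_conv_bounded_linear)
  then have "((\<lambda>y. B y v) has_derivative (\<lambda>h. 0 - B x (Q h))) (at x)"
  proof (rule has_derivative_transform_within_open[OF _ assms(1,2)])
    fix y assume y: "y \<in> S"
    have "B x (q y) = B x v - B y v"
      using lin(2)[OF x] x y by (simp flip: q add: AB BA linear_diff)
    then show "B x v - B x (q y) = B y v" by simp
  qed
  then show ?thesis by (simp add: Q)
qed

text \<open>A bootstrap: the derivative of \<open>B\<close> is built from \<open>B\<close> and the
  derivative of \<open>A\<close>, so order \<open>n\<close> of \<open>B\<close> gives order
  \<open>n\<close> of its derivative.\<close>

lemma C_nat_on_inverse_family:
  fixes A B :: "'a::euclidean_space \<Rightarrow> 'b::euclidean_space \<Rightarrow> 'b"
  assumes "open S"
    and lin: "\<And>x. x \<in> S \<Longrightarrow> linear (A x)" "\<And>x. x \<in> S \<Longrightarrow> linear (B x)"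
    and AB: "\<And>x v. x \<in> S \<Longrightarrow> A x (B x v) = v"
    and BA: "\<And>x v. x \<in> S \<Longrightarrow> B x (A x v) = v"
    and "\<And>v. C_nat_on n S (\<lambda>x. A x v)"
  shows "C_nat_on n S (\<lambda>x. B x v)"
  using assms(6)
proof (induction n arbitrary: v)
  case 0
  then show ?case
    by (simp, intro continuous_on_inverse_family[OF lin AB BA]) (use 0 in auto)
next
  case (Suc n)
  define A' where "A' x v = frechet_derivative (\<lambda>x. A x v) (at x)" for x v
  have A': "((\<lambda>x. A x v) has_derivative A' y v) (at y)" if "y \<in> S" for v y
    unfolding A'_def using C_nat_on_has_derivative[OF Suc.prems that] .
  \<comment> \<open>Linearity in the argument \<open>v\<close> of \<open>A\<close>, not in the
    direction \<open>h\<close> of differentiation; it allows the moving vector \<open>B x v\<close>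
    to be inserted for \<open>v\<close>.\<close>
  have linA': "linear (\<lambda>v. A' x v h)" if x: "x \<in> S" for x h
  proof (rule linearI)
    fix v w :: 'b and c :: real
    have "((\<lambda>x. A x v + A x w) has_derivative (\<lambda>h. A' x v h + A' x w h)) (at x)"
      by (intro has_derivative_add A' x)
    then have "((\<lambda>x. A x (v + w)) has_derivative (\<lambda>h. A' x v h + A' x w h)) (at x)"
      by (rule has_derivative_transform_within_open[OF _ assms(1) x]) (use lin(1) in \<open>simp add: linear_add\<close>)
    then show "A' x (v + w) h = A' x v h + A' x w h"
      using has_derivative_unique[OF A'[OF x]] by metis
    have "((\<lambda>x. c *\<^sub>R A x v) has_derivative (\<lambda>h. c *\<^sub>R A' x v h)) (at x)"
      by (intro has_derivative_scaleR_right A' x)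
    then have "((\<lambda>x. A x (c *\<^sub>R v)) has_derivative (\<lambda>h. c *\<^sub>R A' x v h)) (at x)"
      by (rule has_derivative_transform_within_open[OF _ assms(1) x]) (use lin(1) in \<open>simp add: linear_cmul\<close>)
    then show "A' x (c *\<^sub>R v) h = c *\<^sub>R A' x v h"
      using has_derivative_unique[OF A'[OF x]] by metis
  qed
  have IH: "C_nat_on n S (\<lambda>x. B x v)" for v
    using Suc.IH C_nat_on_SucD[OF Suc.prems] by blast
  show ?case
  proof (rule C_nat_on_SucI[OF assms(1)])
    show "((\<lambda>x. B x v) has_derivative (\<lambda>h. - B x (A' x (B x v) h))) (at x)" if "x \<in> S" for x
      by (rule has_derivative_inverse_family[OF assms(1) that lin AB BA A'])
    have "C_nat_on n S (\<lambda>x. A' x v h)" for v h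
      using Suc.prems[of v] by (simp add: A'_def)
    then have "C_nat_on n S (\<lambda>x. A' x (B x v) h)" for h
      using C_nat_on_linear_family_apply[where A = "\<lambda>x v. A' x v h" and z = "\<lambda>x. B x v" and S = S and n = n]
        assms(1) linA' IH by simp
    then have "C_nat_on n S (\<lambda>x. B x (A' x (B x v) h))" for h
      using C_nat_on_linear_family_apply[where A = B and z = "\<lambda>x. A' x (B x v) h" and S = S and n = n]
        assms(1) lin(2) IH by simp
    then show "C_nat_on n S (\<lambda>x. - B x (A' x (B x v) h))" for h
      by (rule C_nat_on_linear_compose[OF assms(1) bounded_linear_minus[OF bounded_linear_ident]])
  qed
qed

text \<open>Again a bootstrap: \<open>g' y\<close> inverts \<open>Df(g y)\<close>. If
  \<open>g\<close> is of order \<open>n\<close> and \<open>f\<close> of order \<open>n + 1\<close>,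
  then \<open>Df(g y)\<close> is of order \<open>n\<close> in \<open>y\<close>, and so is its
  inverse.\<close>

lemma C_nat_on_inverse_function:
  fixes f g :: "'a::euclidean_space \<Rightarrow> 'a"
  assumes "open T" "\<And>y. y \<in> T \<Longrightarrow> g y \<in> S"
    and g': "\<And>y. y \<in> T \<Longrightarrow> (g has_derivative g' y) (at y)"
    and "\<And>y v. y \<in> T \<Longrightarrow> frechet_derivative f (at (g y)) (g' y v) = v"
    and "\<And>y v. y \<in> T \<Longrightarrow> g' y (frechet_derivative f (at (g y)) v) = v"
    and "C_nat_on n S f"
  shows "C_nat_on n T g"
  using assms(6)
proof (induction n)
  case 0
  then show ?case
    using g' by (auto intro!: continuous_at_imp_continuous_on has_derivative_continuous)
next
  case (Suc n)
  have g: "C_nat_on n T g" using Suc.IH C_nat_on_SucD[OF Suc.prems] .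
  show ?case
  proof (rule C_nat_on_SucI[OF assms(1) g'])
    show "C_nat_on n T (\<lambda>y. g' y v)" for v
    proof (rule C_nat_on_inverse_family[OF assms(1) _ _ assms(4,5)])
      show "linear (frechet_derivative f (at (g y)))" if "y \<in> T" for y
        using Suc.prems that assms(2) by (auto intro: linear_frechet_derivative)
      show "linear (g' y)" if "y \<in> T" for y
        using has_derivative_linear[OF g'[OF that]] .
      show "C_nat_on n T (\<lambda>y. frechet_derivative f (at (g y)) v)" for v
        using Suc.prems
        by (intro C_nat_on_compose[OF assms(1) _ g assms(2)]) simp_all
    qed
  qed
qed

text \<open>The inverse function theorem supplies a differentiable \<open>g\<close> on one fixed
  \<open>V\<close>. The bootstrap then raises its order without shrinking \<open>V\<close>, so that
  the case of infinite \<open>m\<close> is covered as well.\<close>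

lemma C_on_local_inverse:
  fixes f :: "'a::euclidean_space \<Rightarrow> 'a"
  assumes "open S" "x \<in> S" "C_on m S f" "1 \<le> m" "inj (frechet_derivative f (at x))"
  obtains T V g where "open T" "T \<subseteq> S" "x \<in> T" "open V" "homeomorphism T V f g" "C_on m V g"
proof -
  have C1: "C_nat_on (Suc 0) S f"
    using assms(3,4) by (auto simp: C_on_def one_enat_def simp del: C_nat_on.simps)
  define f' where "f' y = Blinfun (frechet_derivative f (at y))" for y
  have f': "blinfun_apply (f' y) = frechet_derivative f (at y)" if "y \<in> S" for y
    unfolding f'_def using C_nat_on_has_derivative[OF C1 that]
    by (intro bounded_linear_Blinfun_apply) (rule has_derivative_bounded_linear)
  have der: "(f has_derivative blinfun_apply (f' y)) (at y)" if "y \<in> S" for y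
    using C_nat_on_has_derivative[OF C1 that] f'[OF that] by simp
  \<comment> \<open>The inverse function theorem wants continuity in operator norm; in finite
    dimension continuity on each basis vector suffices.\<close>
  have cont: "continuous_on S f'"
  proof (rule continuous_on_blinfun_componentwise)
    show "continuous_on S (\<lambda>y. blinfun_apply (f' y) i)" for i
      using C1 by (subst continuous_on_cong[OF refl, where g = "\<lambda>y. frechet_derivative f (at y) i"])
        (auto simp: f')
  qed
  have "linear (frechet_derivative f (at x))"
    using has_derivative_linear[OF C_nat_on_has_derivative[OF C1 assms(2)]] .
  then obtain h where h: "linear h" "h \<circ> frechet_derivative f (at x) = id"
    using linear_injective_left_inverse assms(5) by blast
  have inv: "Blinfun h o\<^sub>L f' x = id_blinfun"
    using h f'[OF assms(2)]
    by (intro blinfun_eqI) (simp add: bounded_linear_Blinfun_apply linear_conv_bounded_linear pointfree_idE)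
  obtain T V g g' where T: "open T" "T \<subseteq> S" "x \<in> T" "open V" "f x \<in> V"
    and hom: "homeomorphism T V f g"
    and g': "\<And>y. y \<in> V \<Longrightarrow> (g has_derivative g' y) (at y)"
      "\<And>y. y \<in> V \<Longrightarrow> g' y = inv (blinfun_apply (f' (g y)))"
      "\<And>y. y \<in> V \<Longrightarrow> bij (blinfun_apply (f' (g y)))"
    using inverse_function_theorem[OF assms(1) der cont assms(2) inv] by metis
  have gS: "g y \<in> S" if "y \<in> V" for y
    using hom T(2) that by (auto simp: homeomorphism_def)
  have "C_on m V g"
    unfolding C_on_def
  proof (intro allI impI)
    fix n assume n: "enat n \<le> m"
    show "C_nat_on n V g"
    proof (rule C_nat_on_inverse_function[OF T(4) gS g'(1)])
      fix y v assume y: "y \<in> V"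
      show "frechet_derivative f (at (g y)) (g' y v) = v"
        using g'(2,3)[OF y] f'[OF gS[OF y]] by (simp add: bij_is_surj surj_f_inv_f)
      show "g' y (frechet_derivative f (at (g y)) v) = v"
        using g'(2,3)[OF y] f'[OF gS[OF y]] by (simp add: bij_is_inj inv_f_f)
    next
      show "C_nat_on n S f" using assms(3) n by (simp add: C_on_def)
    qed
  qed
  with that T hom show ?thesis by blast
qed

subsection \<open>Symmetry of second derivatives\<close>

lemma has_real_derivative_along_line:
  fixes f :: "'a::real_normed_vector \<Rightarrow> real"
  assumes "(f has_derivative f') (at (y + t *\<^sub>R h))"
  shows "((\<lambda>s. f (y + s *\<^sub>R h)) has_real_derivative f' h) (at t)"
proof -
  have "((\<lambda>s. y + s *\<^sub>R h) has_derivative (\<lambda>s. s *\<^sub>R h)) (at t)"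
    by (auto intro!: derivative_eq_intros)
  from has_derivative_compose[OF this assms]
  have "((\<lambda>s. f (y + s *\<^sub>R h)) has_derivative (\<lambda>s. f' (s *\<^sub>R h))) (at t)" .
  moreover have "(\<lambda>s. f' (s *\<^sub>R h)) = (*) (f' h)"
    using linear_cmul[OF has_derivative_linear[OF assms]] by (auto simp: mult.commute)
  ultimately show ?thesis by (simp add: has_field_derivative_def)
qed

text \<open>The mean value theorem is used twice: first along \<open>h\<close> for the increment of
  \<open>f\<close> in direction \<open>s *\<^sub>R k\<close>, then along \<open>k\<close> for the
  directional derivative of \<open>f\<close> in direction \<open>h\<close>.\<close>

lemma double_difference_mean_value:
  fixes f :: "'a::euclidean_space \<Rightarrow> real"
  assumes f: "C_nat_on 2 S f" and "0 < s"
    and S: "\<And>a b. 0 \<le> a \<Longrightarrow> a \<le> s \<Longrightarrow> 0 \<le> b \<Longrightarrow> b \<le> s \<Longrightarrow> x + a *\<^sub>R h + b *\<^sub>R k \<in> S"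
  shows "\<exists>a b. 0 \<le> a \<and> a \<le> s \<and> 0 \<le> b \<and> b \<le> s \<and>
    f (x + s *\<^sub>R h + s *\<^sub>R k) - f (x + s *\<^sub>R h) - f (x + s *\<^sub>R k) + f x =
    s * (s * frechet_derivative (\<lambda>y. frechet_derivative f (at y) h) (at (x + a *\<^sub>R h + b *\<^sub>R k)) k)"
proof -
  let ?D = "\<lambda>y. frechet_derivative f (at y) h"
  have f': "(f has_derivative frechet_derivative f (at y)) (at y)" if "y \<in> S" for y
    using f that by (auto simp: numeral_2_eq_2 frechet_derivative_works)
  have f'': "(?D has_derivative frechet_derivative ?D (at y)) (at y)" if "y \<in> S" for y
    using f that by (auto simp: numeral_2_eq_2 frechet_derivative_works)
  have "\<exists>a. 0 < a \<and> a < s \<and>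
      (f (x + s *\<^sub>R k + s *\<^sub>R h) - f (x + s *\<^sub>R h)) - (f (x + s *\<^sub>R k + 0 *\<^sub>R h) - f (x + 0 *\<^sub>R h)) =
      (s - 0) * (?D (x + s *\<^sub>R k + a *\<^sub>R h) - ?D (x + a *\<^sub>R h))"
  proof (rule MVT2[OF \<open>0 < s\<close>])
    fix a assume a: "0 \<le> a" "a \<le> s"
    show "((\<lambda>a. f (x + s *\<^sub>R k + a *\<^sub>R h) - f (x + a *\<^sub>R h)) has_real_derivative
        ?D (x + s *\<^sub>R k + a *\<^sub>R h) - ?D (x + a *\<^sub>R h)) (at a)"
      using S[OF a, of s] S[OF a, of 0] \<open>0 < s\<close>
      by (intro DERIV_diff has_real_derivative_along_line f') (simp_all add: algebra_simps)
  qed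
  then obtain a where a: "0 < a" "a < s" and
    eq1: "f (x + s *\<^sub>R h + s *\<^sub>R k) - f (x + s *\<^sub>R h) - f (x + s *\<^sub>R k) + f x =
      s * (?D (x + a *\<^sub>R h + s *\<^sub>R k) - ?D (x + a *\<^sub>R h))"
    by (auto simp: algebra_simps)
  have "\<exists>b. 0 < b \<and> b < s \<and> ?D (x + a *\<^sub>R h + s *\<^sub>R k) - ?D (x + a *\<^sub>R h + 0 *\<^sub>R k) =
      (s - 0) * frechet_derivative ?D (at (x + a *\<^sub>R h + b *\<^sub>R k)) k"
    using S a by (intro MVT2[OF \<open>0 < s\<close>] has_real_derivative_along_line f'') simp_all
  then obtain b where b: "0 < b" "b < s" and
    "?D (x + a *\<^sub>R h + s *\<^sub>R k) - ?D (x + a *\<^sub>R h) =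
      s * frechet_derivative ?D (at (x + a *\<^sub>R h + b *\<^sub>R k)) k"
    by auto
  with a eq1 show ?thesis
    by (intro exI[of _ a] exI[of _ b]) simp
qed

text \<open>The double difference is unchanged when \<open>h\<close> and \<open>k\<close> are
  exchanged. Hence the two mixed derivatives coincide at suitable points arbitrarily close to
  \<open>x\<close>, and their continuity excludes a gap at \<open>x\<close>.\<close>

lemma frechet_derivative_symmetric:
  fixes f :: "'a::euclidean_space \<Rightarrow> real"
  assumes f: "C_nat_on 2 S f" and "open S" "x \<in> S"
  shows "frechet_derivative (\<lambda>y. frechet_derivative f (at y) h) (at x) k =
    frechet_derivative (\<lambda>y. frechet_derivative f (at y) k) (at x) h"
proof (rule ccontr)
  define P where "P h k y = frechet_derivative (\<lambda>y. frechet_derivative f (at y) h) (at y) k" for h k y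
  assume "\<not> ?thesis"
  then have "0 < \<bar>P h k x - P k h x\<bar> / 2" by (simp add: P_def)
  \<comment> \<open>Half the gap: values strictly within \<open>e\<close> of the two mixed
    derivatives at \<open>x\<close> cannot be equal.\<close>
  then obtain e where e: "e > 0" "2 * e = \<bar>P h k x - P k h x\<bar>" by (metis field_sum_of_halves mult_2)
  have "isCont (P h k) x" for h k
    using f assms(2,3)
    by (simp add: numeral_2_eq_2 P_def[abs_def] continuous_on_eq_continuous_at)
  then have "\<forall>\<^sub>F y in nhds x. dist (P h k y) (P h k x) < e" for h k
    using e(1) by (auto simp: continuous_at tendsto_at_iff_tendsto_nhds dest: tendstoD)
  then have "\<forall>\<^sub>F y in nhds x. y \<in> S \<and> dist (P h k y) (P h k x) < e \<and> dist (P k h y) (P k h x) < e"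
    using assms(2,3) by (simp add: eventually_conj_iff eventually_nhds_in_open)
  then obtain d where d: "d > 0" and
    near: "\<And>y. dist y x < d \<Longrightarrow> y \<in> S \<and> dist (P h k y) (P h k x) < e \<and> dist (P k h y) (P k h x) < e"
    unfolding eventually_nhds_metric by blast
  \<comment> \<open>Chosen so that \<open>s * c = d / 2\<close>, which keeps the parallelogram
    spanned by \<open>s *\<^sub>R h\<close> and \<open>s *\<^sub>R k\<close> inside the ball of
    radius \<open>d\<close>. The summand 1 avoids division by zero when \<open>h\<close> and
    \<open>k\<close> vanish.\<close>
  define c where "c = norm h + norm k + 1"
  have pos: "0 < c" unfolding c_def by (smt (verit) norm_ge_zero)
  define s where "s = d / (2 * c)"
  have s: "s > 0" using d pos by (simp add: s_def)
  have close: "dist (x + a *\<^sub>R h + b *\<^sub>R k) x < d"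
    if "0 \<le> a" "a \<le> s" "0 \<le> b" "b \<le> s" for a b
  proof -
    have "dist (x + a *\<^sub>R h + b *\<^sub>R k) x = norm (a *\<^sub>R h + b *\<^sub>R k)"
      by (simp add: dist_norm add.assoc)
    also have "\<dots> \<le> a * norm h + b * norm k"
      using that norm_triangle_ineq[of "a *\<^sub>R h" "b *\<^sub>R k"] by simp
    also have "\<dots> \<le> s * norm h + s * norm k"
      using that by (intro add_mono mult_right_mono) auto
    also have "\<dots> \<le> s * c"
      using s by (simp add: c_def algebra_simps)
    also have "\<dots> < d" using d pos by (simp add: s_def)
    finally show ?thesis .
  qed
  obtain a b where ab: "0 \<le> a" "a \<le> s" "0 \<le> b" "b \<le> s" and
    1: "f (x + s *\<^sub>R h + s *\<^sub>R k) - f (x + s *\<^sub>R h) - f (x + s *\<^sub>R k) + f x =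
      s * (s * P h k (x + a *\<^sub>R h + b *\<^sub>R k))"
    using double_difference_mean_value[OF f s, of x h k] close near unfolding P_def by blast
  have close': "dist (x + b *\<^sub>R k + a *\<^sub>R h) x < d"
    if "0 \<le> a" "a \<le> s" "0 \<le> b" "b \<le> s" for a b
    using close[OF that] by (simp add: algebra_simps)
  obtain a' b' where ab': "0 \<le> a'" "a' \<le> s" "0 \<le> b'" "b' \<le> s" and
    2: "f (x + s *\<^sub>R k + s *\<^sub>R h) - f (x + s *\<^sub>R k) - f (x + s *\<^sub>R h) + f x =
      s * (s * P k h (x + a' *\<^sub>R k + b' *\<^sub>R h))"
    using double_difference_mean_value[OF f s, of x k h] close' near unfolding P_def by blast
  have swap: "x + s *\<^sub>R k + s *\<^sub>R h = x + s *\<^sub>R h + s *\<^sub>R k" by (simp add: algebra_simps)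
  from 1 2[unfolded swap] have "s * (s * P h k (x + a *\<^sub>R h + b *\<^sub>R k)) = s * (s * P k h (x + a' *\<^sub>R k + b' *\<^sub>R h))"
    by linarith
  then have "P h k (x + a *\<^sub>R h + b *\<^sub>R k) = P k h (x + a' *\<^sub>R k + b' *\<^sub>R h)"
    using s by simp
  moreover have "dist (P h k (x + a *\<^sub>R h + b *\<^sub>R k)) (P h k x) < e"
    using near close[OF ab] by blast
  moreover have "dist (P k h (x + a' *\<^sub>R k + b' *\<^sub>R h)) (P k h x) < e"
    using near close'[OF ab'(3,4,1,2)] by blast
  ultimately show False
    using e(2) by (simp add: dist_real_def)
qed

subsection \<open>The reduction\<close>

lemma orthogonal_comp_span_singleton: "(span {v})\<^sup>\<bottom> = {x. x \<bullet> v = 0}"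
  by (auto simp: orthogonal_comp_def orthogonal_def span_singleton inner_commute)

text \<open>Two candidates for the projection differ by a vector in both \<open>S\<close> and its
  complement, hence orthogonal to itself; this settles the definite description.\<close>

lemma orth_proj_eqI:
  assumes "subspace S" "y \<in> S" "x - y \<in> S\<^sup>\<bottom>"
  shows "orth_proj S x = y"
  unfolding orth_proj_def
proof (rule the_equality)
  fix z assume z: "z \<in> S \<and> x - z \<in> S\<^sup>\<bottom>"
  have "z - y \<in> S" using z assms by (simp add: subspace_diff)
  moreover have "(x - y) - (x - z) \<in> S\<^sup>\<bottom>"
    using z assms(3) subspace_orthogonal_comp subspace_diff by blast
  ultimately have "(z - y) \<bullet> (z - y) = 0"
    by (auto simp: orthogonal_comp_def orthogonal_def)
  then show "z = y" by simp
qed (use assms in simp)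

lemma diff_inner_scaleR_in_orthogonal_comp:
  assumes "norm v = 1"
  shows "x - (x \<bullet> v) *\<^sub>R v \<in> (span {v})\<^sup>\<bottom>"
  using assms by (simp add: orthogonal_comp_span_singleton inner_diff_left norm_eq_1)

lemma orth_proj_span_singleton:
  assumes "norm v = 1"
  shows "orth_proj (span {v}) x = (x \<bullet> v) *\<^sub>R v"
  by (intro orth_proj_eqI diff_inner_scaleR_in_orthogonal_comp[OF assms] span_scale span_base) simp_all

lemma orth_proj_span_singleton_comp:
  assumes "norm v = 1"
  shows "orth_proj ((span {v})\<^sup>\<bottom>) x = x - (x \<bullet> v) *\<^sub>R v"
proof (intro orth_proj_eqI subspace_orthogonal_comp diff_inner_scaleR_in_orthogonal_comp[OF assms])
  have "(x \<bullet> v) *\<^sub>R v \<in> span {v}" by (intro span_scale span_base) simp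
  then show "x - (x - (x \<bullet> v) *\<^sub>R v) \<in> (span {v})\<^sup>\<bottom>\<^sup>\<bottom>"
    by (simp add: orthogonal_comp_self)
qed

text \<open>Smoothness is assumed for \<open>L\<close> jointly in both variables, whereas
  \<open>F\<close> is a gradient in \<open>u\<close> alone. This link lets \<open>F\<close> inherit
  its regularity from the joint derivative.\<close>

lemma gderiv_eq_frechet_derivative:
  fixes L :: "'a::euclidean_space \<Rightarrow> real \<Rightarrow> real"
  assumes "(\<lambda>(u, \<mu>). L u \<mu>) differentiable (at (u, \<mu>))" "GDERIV (\<lambda>x. L x \<mu>) u :> z"
  shows "frechet_derivative (\<lambda>(u, \<mu>). L u \<mu>) (at (u, \<mu>)) (h, 0) = h \<bullet> z"
proof -
  have "((\<lambda>x. (x, \<mu>)) has_derivative (\<lambda>h. (h, 0))) (at u)"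
    by (auto intro!: derivative_eq_intros)
  from has_derivative_compose[OF this] assms(1)
  have "((\<lambda>x. L x \<mu>) has_derivative
      (\<lambda>h. frechet_derivative (\<lambda>(u, \<mu>). L u \<mu>) (at (u, \<mu>)) (h, 0))) (at u)"
    by (fastforce simp: frechet_derivative_works)
  then show ?thesis
    using has_derivative_unique[OF _ assms(2)[unfolded gderiv_def]] by metis
qed

text \<open>The order is \<open>k - 1\<close> because one derivative of \<open>L\<close> is spent on
  the gradient; for infinite \<open>k\<close> it is again infinite. In the uniqueness clause the
  competing \<open>w'\<close> is tied to \<open>w\<close> only by its value at the origin, and
  connectedness of \<open>U'\<close> carries the agreement to all of \<open>U'\<close>.\<close>

theorem lemma4p1:
  fixes L :: "'a::euclidean_space \<Rightarrow> real \<Rightarrow> real"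
    and F :: "'a \<Rightarrow> real \<Rightarrow> 'a"
    and D :: "('a \<times> real) set"
    and H :: "'a \<Rightarrow> 'a"
    and v0 :: 'a
    and N R :: "'a set"
    and k :: enat
  assumes "4 \<le> k"
    and "open D" and "(0, 0) \<in> D"
    and "C_on k D (\<lambda>(u, \<mu>). L u \<mu>)"
    and "\<And>u \<mu>. (u, \<mu>) \<in> D \<Longrightarrow> GDERIV (\<lambda>x. L x \<mu>) u :> F u \<mu>"
    and "\<forall>\<^sub>F \<mu> in nhds 0. F 0 \<mu> = 0"
    and "((\<lambda>u. F u 0) has_derivative H) (at 0)"
    and "N = {x. H x = 0}" and "N = span {v0}" and "norm v0 = 1"
    and "R = N\<^sup>\<bottom>"
  shows "\<exists>(U :: (real \<times> real) set) (V :: ('a \<times> real) set) (w :: real \<times> real \<Rightarrow> 'a).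
    open U \<and> connected U \<and> (0, 0) \<in> U \<and>
    solves_projected (k - 1) D F v0 R U w \<and>
    (\<forall>U' w'. open U' \<and> connected U' \<and> (0, 0) \<in> U' \<and> U' \<subseteq> U \<and>
        solves_projected (k - 1) D F v0 R U' w' \<longrightarrow> (\<forall>p\<in>U'. w' p = w p)) \<and>
    open V \<and> (0, 0) \<in> V \<and> V \<subseteq> D \<and>
    bij_betw (\<lambda>(a, \<mu>). (a *\<^sub>R v0 + w (a, \<mu>), \<mu>))
      {(a, \<mu>). (a, \<mu>) \<in> U \<and> reduced_map F v0 N w a \<mu> = 0}
      {(u, \<mu>). (u, \<mu>) \<in> V \<and> F u \<mu> = 0} \<and>
    (\<forall>(a, \<mu>)\<in>U.
      ((\<lambda>s. reduced_potential L v0 w s \<mu>) has_real_derivative reduced_map F v0 N w a \<mu>) (at a))"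
proof -
  let ?L = "\<lambda>(u, \<mu>). L u \<mu>"

  \<comment> \<open>Regularity of the gradient\<close>
  define m where "m = k - 1"
  have Suc_le: "enat (Suc n) \<le> k" if "enat n \<le> m" for n
    using that assms(1) by (cases k) (auto simp: m_def one_enat_def numeral_eq_enat)
  have m: "1 \<le> m"
    using assms(1) by (cases k) (auto simp: m_def one_enat_def numeral_eq_enat)
  have L: "C_nat_on n D ?L" if "enat n \<le> k" for n
    using assms(4) that by (simp add: C_on_def)
  have "enat 2 \<le> k" by (rule order_trans[OF _ assms(1)]) (simp add: numeral_eq_enat)
  note L2 = L[OF this]
  have L': "frechet_derivative ?L (at (u, \<mu>)) (h, 0) = h \<bullet> F u \<mu>" if "(u, \<mu>) \<in> D" for u \<mu> h
    using gderiv_eq_frechet_derivative[where L = L, OF _ assms(5)[OF that]] L2 that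
    by (simp add: numeral_2_eq_2)
  \<comment> \<open>The coordinates of \<open>F\<close> are the derivatives of the joint map in the
    directions \<open>(i, 0)\<close>, so \<open>F\<close> is reassembled from them.\<close>
  have F: "C_nat_on n D (\<lambda>p. F (fst p) (snd p))" if "enat n \<le> m" for n
  proof (rule C_nat_on_cong[OF assms(2)])
    show "C_nat_on n D (\<lambda>p. \<Sum>i\<in>Basis. frechet_derivative ?L (at p) (i, 0) *\<^sub>R i)"
      using L[OF Suc_le[OF that]]
      by (intro C_nat_on_sum C_nat_on_scaleR C_nat_on_const assms(2)) simp
    show "(\<Sum>i\<in>Basis. frechet_derivative ?L (at p) (i, 0) *\<^sub>R i) = F (fst p) (snd p)" if "p \<in> D" for p
      using that L' by (cases p) (simp add: inner_commute[of _ "F _ _"] euclidean_representation)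
  qed

  \<comment> \<open>Symmetry and range of the Hessian\<close>
  have v0: "v0 \<bullet> v0 = 1" using assms(10) by (simp add: norm_eq_1)
  have linH: "linear H" using has_derivative_linear[OF assms(7)] .

  \<comment> \<open>\<open>H\<close> is given through the slice \<open>\<mu> = 0\<close>, while the
    symmetry lemma speaks of the joint map on \<open>D\<close>. Restricting the derivative of the
    joint map to directions \<open>(h, 0)\<close> identifies the two.\<close>
  have H_eq: "frechet_derivative (\<lambda>p. frechet_derivative ?L (at p) (j, 0)) (at (0, 0)) (h, 0) = j \<bullet> H h" for h j
  proof -
    let ?f = "\<lambda>p. frechet_derivative ?L (at p) (j, 0)"
    have f: "(?f has_derivative frechet_derivative ?f (at (0, 0))) (at (0, 0))"
      using L2 assms(3) by (simp add: numeral_2_eq_2 frechet_derivative_works)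
    have "((\<lambda>u :: 'a. (u, 0 :: real)) has_derivative (\<lambda>h. (h, 0))) (at 0)"
      by (auto intro!: derivative_eq_intros)
    from has_derivative_compose[OF this f]
    have 1: "((\<lambda>u. ?f (u, 0)) has_derivative (\<lambda>h. frechet_derivative ?f (at (0, 0)) (h, 0))) (at 0)" .
    have "open ((\<lambda>u :: 'a. (u, 0 :: real)) -` D)"
      by (intro open_vimage assms(2) continuous_intros)
    then have "((\<lambda>u. j \<bullet> F u 0) has_derivative (\<lambda>h. frechet_derivative ?f (at (0, 0)) (h, 0))) (at 0)"
      using assms(3) L' by (intro has_derivative_transform_within_open[OF 1]) auto
    from has_derivative_unique[OF this has_derivative_inner_right[OF assms(7)]] show ?thesis
      by metis
  qed
  have H_sym: "j \<bullet> H h = h \<bullet> H j" for h j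
    using frechet_derivative_symmetric[OF L2 assms(2,3), of "(j, 0)" "(h, 0)"] by (simp only: H_eq)
  have H_v0: "H z \<bullet> v0 = 0" for z
  proof -
    have "v0 \<in> N" using assms(9) by (simp add: span_base)
    then have "H v0 = 0" using assms(8) by simp
    then show ?thesis using H_sym[of v0 z] by (simp add: inner_commute)
  qed

  \<comment> \<open>The augmented map and its derivative at the origin\<close>
  define P where "P z = z - (z \<bullet> v0) *\<^sub>R v0" for z
  have P: "bounded_linear P"
    unfolding P_def
    by (intro bounded_linear_sub bounded_linear_ident bounded_linear_compose[OF bounded_linear_scaleR_left bounded_linear_inner_left])
  have P_v0: "P z \<bullet> v0 = 0" for z by (simp add: P_def inner_diff_left v0)
  have proj: "orth_proj R z = P z" "orth_proj N z = (z \<bullet> v0) *\<^sub>R v0" for z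
    using assms(9-11) by (simp_all add: P_def orth_proj_span_singleton orth_proj_span_singleton_comp)
  have R: "z \<in> R \<longleftrightarrow> z \<bullet> v0 = 0" for z
    using assms(9,11) by (simp add: orthogonal_comp_span_singleton)
  have red: "reduced_map F v0 N w a \<mu> = F (a *\<^sub>R v0 + w (a, \<mu>)) \<mu> \<bullet> v0" for w a \<mu>
    by (simp add: reduced_map_def proj v0)

  \<comment> \<open>\<open>P\<close> loses the \<open>v0\<close>-component; the summand with
    \<open>v0\<close> fills that slot with the coordinate \<open>a\<close> of \<open>u\<close>, and
    the second component retains \<open>\<mu>\<close>.\<close>
  define G where "G p = (P (F (fst p) (snd p)) + (fst p \<bullet> v0) *\<^sub>R v0, snd p)" for p
  have G_C: "C_on m D G"
    unfolding C_on_def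
  proof (intro allI impI)
    fix n assume n: "enat n \<le> m"
    have "bounded_linear (\<lambda>z. (P z, 0 :: real))"
      by (intro bounded_linear_Pair P bounded_linear_zero)
    then have 1: "C_nat_on n D (\<lambda>p. (P (F (fst p) (snd p)), 0 :: real))"
      using C_nat_on_linear_compose[OF assms(2) _ F[OF n]] by blast
    have "bounded_linear (\<lambda>p :: 'a \<times> real. ((fst p \<bullet> v0) *\<^sub>R v0, snd p))"
      by (intro bounded_linear_Pair bounded_linear_snd
          bounded_linear_compose[OF bounded_linear_scaleR_left
            bounded_linear_compose[OF bounded_linear_inner_left bounded_linear_fst]])
    then have "C_nat_on n D (\<lambda>p. ((fst p \<bullet> v0) *\<^sub>R v0, snd p))"
      by (rule C_nat_on_bounded_linear[OF assms(2)])
    from C_nat_on_add[OF assms(2) 1 this] show "C_nat_on n D G"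
      by (simp add: G_def[abs_def])
  qed
  let ?G' = "frechet_derivative G (at (0, 0))"
  have "C_nat_on (Suc 0) D G"
    using G_C m by (auto simp: C_on_def one_enat_def simp del: C_nat_on.simps)
  from C_nat_on_has_derivative[OF this assms(3)]
  have G': "(G has_derivative ?G') (at (0, 0))" .
  have inj: "inj ?G'"
  proof (rule linear_injective_0[THEN iffD2, OF has_derivative_linear[OF G']], safe)
    fix h t assume 0: "?G' (h, t) = (0 :: 'a \<times> real)"
    \<comment> \<open>The second component of \<open>G\<close> is just the parameter, so
      \<open>t = 0\<close>. After that only the slice \<open>\<mu> = 0\<close> matters, where the
      derivative is expressed through \<open>H\<close>.\<close>
    have "((\<lambda>p. snd (G p)) has_derivative (\<lambda>p. snd (?G' p))) (at (0, 0))"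
      by (rule has_derivative_snd[OF G'])
    moreover have "((\<lambda>p. snd (G p)) has_derivative snd) (at (0, 0))"
      by (simp add: G_def bounded_linear_imp_has_derivative bounded_linear_snd)
    ultimately have "snd (?G' (h, t)) = t"
      using has_derivative_unique by (metis snd_conv)
    with 0 have t: "t = 0" by simp
    have "((\<lambda>u :: 'a. (u, 0 :: real)) has_derivative (\<lambda>h. (h, 0))) (at 0)"
      by (auto intro!: derivative_eq_intros)
    from has_derivative_compose[OF this G']
    have "((\<lambda>u. fst (G (u, 0))) has_derivative (\<lambda>h. fst (?G' (h, 0)))) (at 0)"
      by (rule has_derivative_fst)
    moreover have "((\<lambda>u. P (F u 0) + (u \<bullet> v0) *\<^sub>R v0) has_derivative (\<lambda>h. P (H h) + (h \<bullet> v0) *\<^sub>R v0)) (at 0)"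
      by (intro has_derivative_add bounded_linear.has_derivative[OF P assms(7)]
          has_derivative_scaleR_left has_derivative_inner_left has_derivative_ident)
    ultimately have "P (H h) + (h \<bullet> v0) *\<^sub>R v0 = fst (?G' (h, 0))"
      using has_derivative_unique by (fastforce simp: G_def dest: fun_cong)
    then have *: "H h + (h \<bullet> v0) *\<^sub>R v0 = 0"
      using 0 t by (simp add: P_def H_v0)
    \<comment> \<open>Pairing with \<open>v0\<close> removes \<open>H h\<close>, whose values are
      orthogonal to \<open>v0\<close>. So \<open>h\<close> has no \<open>v0\<close>-component and
      lies in the kernel, that is, in the span of \<open>v0\<close>.\<close>
    then have "(H h + (h \<bullet> v0) *\<^sub>R v0) \<bullet> v0 = 0" by simp
    then have hv: "h \<bullet> v0 = 0" by (simp add: inner_add_left H_v0 v0)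
    with * have "h \<in> N" using assms(8) by simp
    then obtain c where "h = c *\<^sub>R v0" using assms(9) by (auto simp: span_singleton)
    with hv v0 have "h = 0" by simp
    with t show "(h, t) = 0" by (simp add: zero_prod_def)
  qed

  \<comment> \<open>The solution branch from the local inverse\<close>
  obtain T V' g where T: "open T" "T \<subseteq> D" "(0, 0) \<in> T" "open V'"
    and hom: "homeomorphism T V' G g" and g_C: "C_on m V' g"
    using C_on_local_inverse[OF assms(2,3) G_C m inj] by metis
  have gG: "g (G p) = p" if "p \<in> T" for p using hom that by (simp add: homeomorphism_def)
  have Gg: "G (g q) = q" "g q \<in> T" if "q \<in> V'" for q
    using hom that by (auto simp: homeomorphism_def)
  have GT: "G p \<in> V'" if "p \<in> T" for p using hom that by (auto simp: homeomorphism_def)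
  \<comment> \<open>A property that holds eventually in \<open>nhds 0\<close> holds at 0 itself, so
    the critical branch gives \<open>F 0 0 = 0\<close>.\<close>
  have G0: "G (0, 0) = (0, 0)"
    using eventually_nhds_x_imp_x[OF assms(6)] by (simp add: G_def P_def)

  define \<iota> where "\<iota> p = (fst p *\<^sub>R v0, snd p)" for p :: "real \<times> real"
  have \<iota>: "bounded_linear \<iota>"
    unfolding \<iota>_def
    by (intro bounded_linear_Pair bounded_linear_snd
        bounded_linear_compose[OF bounded_linear_scaleR_left bounded_linear_fst])
  have "open (\<iota> -` V')"
    by (intro open_vimage T(4) linear_continuous_on \<iota>)
  moreover have "(0, 0) \<in> \<iota> -` V'"
    using GT[OF T(3)] by (simp add: G0 \<iota>_def)
  \<comment> \<open>A ball is taken because \<open>U\<close> has to be connected.\<close>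
  ultimately obtain r where r: "r > 0" "ball (0, 0) r \<subseteq> \<iota> -` V'"
    using open_contains_ball by metis
  define U where "U = (ball (0, 0) r :: (real \<times> real) set)"
  have U: "open U" "connected U" "(0, 0) \<in> U" and U_V': "\<And>p. p \<in> U \<Longrightarrow> \<iota> p \<in> V'"
    using r by (auto simp: U_def)
  have sol_iff: "G (a *\<^sub>R v0 + z, \<mu>) = \<iota> (a, \<mu>) \<longleftrightarrow> P (F (a *\<^sub>R v0 + z) \<mu>) = 0"
    if "z \<in> R" for a z \<mu>
    using that by (simp add: G_def \<iota>_def R inner_add_left v0)

  define w where "w p = fst (g (\<iota> p)) - fst p *\<^sub>R v0" for p
  have g_eq: "g (\<iota> (a, \<mu>)) = (a *\<^sub>R v0 + w (a, \<mu>), \<mu>)" and w_R: "w (a, \<mu>) \<in> R"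
    if "(a, \<mu>) \<in> U" for a \<mu>
  proof -
    have G: "G (g (\<iota> (a, \<mu>))) = \<iota> (a, \<mu>)" using Gg(1)[OF U_V'[OF that]] .
    then have "snd (g (\<iota> (a, \<mu>))) = \<mu>" by (simp add: G_def \<iota>_def)
    then show "g (\<iota> (a, \<mu>)) = (a *\<^sub>R v0 + w (a, \<mu>), \<mu>)" by (simp add: w_def prod_eq_iff)
    \<comment> \<open>Values of \<open>P\<close> are orthogonal to \<open>v0\<close>, so the
      \<open>v0\<close>-component of the first part of \<open>G (u, \<mu>)\<close> is that of
      \<open>u\<close>. It therefore equals \<open>a\<close>, and subtracting
      \<open>a *\<^sub>R v0\<close> leaves a vector in \<open>R\<close>.\<close>
    have "fst (G (g (\<iota> (a, \<mu>)))) \<bullet> v0 = a" unfolding G by (simp add: \<iota>_def v0)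
    then show "w (a, \<mu>) \<in> R"
      by (simp add: G_def R w_def inner_add_left inner_diff_left P_v0 v0)
  qed
  have w_T: "(a *\<^sub>R v0 + w (a, \<mu>), \<mu>) \<in> T"
    and w_P: "P (F (a *\<^sub>R v0 + w (a, \<mu>)) \<mu>) = 0" if "(a, \<mu>) \<in> U" for a \<mu>
    using Gg[OF U_V'[OF that]] sol_iff[OF w_R[OF that]] by (simp_all add: g_eq[OF that])
  have w_C: "C_on m U w"
    unfolding C_on_def
  proof (intro allI impI)
    fix n assume "enat n \<le> m"
    then have "C_nat_on n V' g" using g_C by (simp add: C_on_def)
    then have "C_nat_on n U (\<lambda>p. g (\<iota> p))"
      by (rule C_nat_on_compose[OF U(1) _ C_nat_on_bounded_linear[OF U(1) \<iota>] U_V'])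
    then have 1: "C_nat_on n U (\<lambda>p. fst (g (\<iota> p)))"
      by (rule C_nat_on_linear_compose[OF U(1) bounded_linear_fst])
    have "bounded_linear (\<lambda>p :: real \<times> real. - (fst p *\<^sub>R v0))"
      by (intro bounded_linear_minus bounded_linear_compose[OF bounded_linear_scaleR_left bounded_linear_fst])
    then have "C_nat_on n U (\<lambda>p :: real \<times> real. - (fst p *\<^sub>R v0))"
      by (rule C_nat_on_bounded_linear[OF U(1)])
    from C_nat_on_add[OF U(1) 1 this] show "C_nat_on n U w"
      by (simp add: w_def[abs_def])
  qed
  have w0: "w (0, 0) = 0"
    using gG[OF T(3)] by (simp add: w_def \<iota>_def G0)
  have w_sol: "solves_projected m D F v0 R U w"
    using w_C w0 w_R w_T w_P T(2) by (auto simp: solves_projected_def proj)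

  \<comment> \<open>By injectivity of \<open>G\<close> on \<open>T\<close>, \<open>w'\<close> and \<open>w\<close> agree exactly where the graph of \<open>w'\<close> lies in the open
    set \<open>T\<close>; so the set of agreement is open as well as closed in the connected \<open>U'\<close>.\<close>
  have unique: "w' p = w p"
    if U': "open U'" "connected U'" "(0, 0) \<in> U'" "U' \<subseteq> U"
      and w': "solves_projected m D F v0 R U' w'" and p: "p \<in> U'" for U' w' p
  proof -
    have "C_on m U w" "C_on m U' w'" using w_C w' by (simp_all add: solves_projected_def)
    then have cont: "continuous_on U' w" "continuous_on U' w'"
      using continuous_on_subset[OF _ U'(4)] by (auto simp: C_on_def dest!: spec[of _ 0] simp: zero_enat_def[symmetric])
    let ?q = "\<lambda>p. (fst p *\<^sub>R v0 + w' p, snd p)"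
    have agree: "w' p = w p \<longleftrightarrow> ?q p \<in> T" if "p \<in> U'" for p
    proof -
      obtain a \<mu> where p: "p = (a, \<mu>)" by (cases p)
      have "G (?q p) = \<iota> p"
        using w' that sol_iff[of "w' p" a \<mu>] by (auto simp: solves_projected_def proj p)
      then show ?thesis
        using gG[of "?q p"] w_T[of a \<mu>] g_eq[of a \<mu>] that U'(4) by (auto simp: p)
    qed
    have "openin (top_of_set U') (U' \<inter> ?q -` T)"
      by (intro continuous_openin_preimage_gen continuous_intros cont T(1))
    moreover have "U' \<inter> ?q -` T = {p \<in> U'. w' p = w p}" using agree by auto
    ultimately have "openin (top_of_set U') {p \<in> U'. w' p = w p}" by simp
    moreover have "closedin (top_of_set U') {p \<in> U'. w' p = w p}"
      using continuous_closedin_preimage_constant[OF continuous_on_diff[OF cont(2,1)], of 0] by simp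
    moreover have "(0, 0) \<in> {p \<in> U'. w' p = w p}"
      using U'(3) w0 w' by (simp add: solves_projected_def)
    ultimately have "{p \<in> U'. w' p = w p} = U'"
      using U'(2) unfolding connected_clopen by blast
    with p show ?thesis by blast
  qed

  \<comment> \<open>Correspondence of critical points with zeros of the reduced map\<close>
  define V where "V = T \<inter> (\<lambda>p. (fst p \<bullet> v0, snd p)) -` U"
  have V: "open V" "(0, 0) \<in> V" "V \<subseteq> D"
    using T U by (auto simp: V_def intro!: open_Int open_vimage continuous_intros)
  have u_v0: "(a *\<^sub>R v0 + w (a, \<mu>)) \<bullet> v0 = a" if "(a, \<mu>) \<in> U" for a \<mu>
    using w_R[OF that] by (simp add: R inner_add_left v0)
  have u_V: "(a *\<^sub>R v0 + w (a, \<mu>), \<mu>) \<in> V" if "(a, \<mu>) \<in> U" for a \<mu>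
    using w_T[OF that] u_v0[OF that] that by (simp add: V_def)
  have u_F: "F (a *\<^sub>R v0 + w (a, \<mu>)) \<mu> = 0"
    if "(a, \<mu>) \<in> U" "reduced_map F v0 N w a \<mu> = 0" for a \<mu>
    using w_P[OF that(1)] that(2) by (simp add: red P_def)
  \<comment> \<open>This is the reason for cutting \<open>T\<close> down to \<open>V\<close>: every
    critical point in \<open>V\<close> has an admissible parameter
    \<open>a = u \<bullet> v0\<close>.\<close>
  have a_U: "(u \<bullet> v0, \<mu>) \<in> U" if "(u, \<mu>) \<in> V" for u \<mu>
    using that by (simp add: V_def)
  have a_u: "(u \<bullet> v0) *\<^sub>R v0 + w (u \<bullet> v0, \<mu>) = u" if "(u, \<mu>) \<in> V" "F u \<mu> = 0" for u \<mu>
  proof -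
    \<comment> \<open>A zero of \<open>F\<close> solves the projected equation in particular, so
      injectivity of \<open>G\<close> on \<open>T\<close> puts it on the graph of
      \<open>w\<close>.\<close>
    have "G (u, \<mu>) = \<iota> (u \<bullet> v0, \<mu>)" using that(2) by (simp add: G_def \<iota>_def P_def)
    then show ?thesis
      using gG[of "(u, \<mu>)"] g_eq[OF a_U[OF that(1)]] that(1) by (simp add: V_def)
  qed
  have bij: "bij_betw (\<lambda>(a, \<mu>). (a *\<^sub>R v0 + w (a, \<mu>), \<mu>))
      {(a, \<mu>). (a, \<mu>) \<in> U \<and> reduced_map F v0 N w a \<mu> = 0} {(u, \<mu>). (u, \<mu>) \<in> V \<and> F u \<mu> = 0}"
    by (rule bij_betwI[where g = "\<lambda>(u, \<mu>). (u \<bullet> v0, \<mu>)"])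
      (auto simp: u_v0 u_V u_F a_U a_u red)

  \<comment> \<open>The gradient of the reduced potential\<close>
  have pot: "((\<lambda>s. reduced_potential L v0 w s \<mu>) has_real_derivative reduced_map F v0 N w a \<mu>) (at a)"
    if a: "(a, \<mu>) \<in> U" for a \<mu>
  proof -
    let ?u = "\<lambda>s. s *\<^sub>R v0 + w (s, \<mu>)"
    have "C_nat_on (Suc 0) U w"
      using w_C m by (auto simp: C_on_def one_enat_def simp del: C_nat_on.simps)
    from C_nat_on_has_derivative[OF this a]
    have w': "(w has_derivative frechet_derivative w (at (a, \<mu>))) (at (a, \<mu>))" .
    have "((\<lambda>s. (s, \<mu>)) has_derivative (\<lambda>h. (h, 0))) (at a)"
      by (auto intro!: derivative_eq_intros)
    from has_derivative_compose[OF this w']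
    have u': "(?u has_derivative (\<lambda>h. h *\<^sub>R v0 + frechet_derivative w (at (a, \<mu>)) (h, 0))) (at a)"
      (is "(_ has_derivative ?u') _")
      by (intro has_derivative_add has_derivative_scaleR_left has_derivative_ident)
    have "open ((\<lambda>s. (s, \<mu>)) -` U)"
      by (intro open_vimage U continuous_intros)
    \<comment> \<open>As \<open>w\<close> takes values in \<open>R\<close>, the
      \<open>v0\<close>-component of \<open>?u s\<close> is \<open>s\<close> for all
      \<open>s\<close> near \<open>a\<close>. Differentiating this identity gives the
      \<open>v0\<close>-component of \<open>?u'\<close> with no knowledge of the derivative of
      \<open>w\<close>.\<close>
    then have "((\<lambda>s. ?u s \<bullet> v0) has_derivative (\<lambda>h. h)) (at a)"
      using a by (intro has_derivative_transform_within_open[OF has_derivative_ident]) (auto simp: u_v0)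
    from has_derivative_unique[OF has_derivative_inner_left[OF u'] this]
    have u'_v0: "?u' h \<bullet> v0 = h" for h by metis
    have F_eq: "F (?u a) \<mu> = (F (?u a) \<mu> \<bullet> v0) *\<^sub>R v0"
      using w_P[OF a] by (simp add: P_def)
    have "GDERIV (\<lambda>x. L x \<mu>) (?u a) :> F (?u a) \<mu>"
      using w_T[OF a] T(2) by (intro assms(5)) auto
    from has_derivative_compose[OF u' this[unfolded gderiv_def]]
    have "((\<lambda>s. L (?u s) \<mu>) has_derivative (\<lambda>h. ?u' h \<bullet> F (?u a) \<mu>)) (at a)" .
    moreover have "?u' h \<bullet> F (?u a) \<mu> = (F (?u a) \<mu> \<bullet> v0) * h" for h
      by (subst F_eq) (simp only: inner_scaleR_right u'_v0)
    ultimately show ?thesis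
      by (simp only: reduced_potential_def red has_field_derivative_def)
  qed

  show ?thesis
    using U V w_sol unique bij pot
    unfolding m_def by (intro exI[of _ U] exI[of _ V] exI[of _ w]) blast
qed

end
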